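(* Let $q\ge 2$ and $d=2q-3$, let $I$ be a parity class of $Q_d$ with complementary parity class $D$, and fix a coordinate $j_0\in[d]$. Deleting coordinate $j_0$ identifies $D$ with $\mathbb F_2^{2q-4}$ (whose coordinates are indexed by $[d]\setminus\{j_0\}$). Under this identification, the extremal pair-defensive $q$-colourings $c$ of $Q_d$ (with attacked parity $I$) whose defect coordinate is constant equal to $j_0$, i.e. $\delta(b)=j_0$ for every $b\in D$, correspond (bijectively, via $c\mapsto\gamma$, where $\gamma$ is $c|_D$ transported to $\mathbb F_2^{2q-4}$) to the maps $$\gamma:\mathbb F_2^{2q-4}\to[q]$$ satisfying the following two conditions for every $v\in\mathbb F_2^{2q-4}$: (i) $\gamma(v+e_j)\ne\gamma(v)$ for every remaining coordinate $j\in[d]\setminus\{j_0\}$; (ii) the set $$\bigl\{\{j,\ell\}\subseteq[d]\setminus\{j_0\}: j\ne\ell\text{ and }\gamma(v+e_j+e_\ell)=\gamma(v)\bigr\}$$ is a perfect matching of the $2q-4$ remaining coordinates.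
   Context: The hypercube $Q_d$ is the graph on $\mathbb F_2^d$ in which two vertices are adjacent when they differ in exactly one coordinate; $e_j$ is the standard basis vector of coordinate $j$, and $[n]=\{1,\dots,n\}$. Its two parity classes are the vectors of even Hamming weight and those of odd Hamming weight; $I$ is one of them (the attacked parity) and $D$ the other (the defender parity). $N(x)$ is the open neighbourhood in $Q_d$ and $N[x]=N(x)\cup\{x\}$. A pair-defensive $q$-colouring with attacked parity $I$ (an $(I,2,q)$-defensive silver colouring) is a surjective proper colouring $c:V(Q_d)\to[q]$, with colour classes $C_i=c^{-1}(i)$, such that for every colour $i\in[q]$ and every $S\subseteq I$ with $|S|\le 2$ there is an injective map $f:S\to C_i$ with $f(x)\in N[x]$ for all $x\in S$. Such a colouring is called extremal if it attains the bound $q=\lfloor (d+3)/2\rfloor$ on the number of colours; for $d=2q-3$ this means simply that it uses $q$ colours. For an extremal colouring $c$ and $b\in D$, the link of $b$ is $L_b=\{\{j,\ell\}\subseteq[d]: j\ne\ell,\ c(b+e_j+e_\ell)=c(b)\}$. For extremal colourings of $Q_{2q-3}$ each $L_b$ is a matching on $[d]$ (pairwise disjoint pairs) covering all but exactly one coordinate; the uncovered coordinate is the defect coordinate $\delta(b)$. A perfect matching of a finite set is a set of pairwise disjoint two-element subsets covering the whole set. *)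

theory Defs
  imports Main "HOL-Library.FuncSet" "HOL-Library.Function_Algebras" "HOL-Library.Z2"
begin

text \<open>
  The vector space of bit vectors with coordinates indexed by \<open>J\<close>. Vectors are total functions
  vanishing outside \<open>J\<close>, so that pointwise addition on functions is the vector addition
  for every \<open>J\<close>.
\<close>
definition cube :: "nat set \<Rightarrow> (nat \<Rightarrow> bit) set" where
  "cube J = {x. \<forall>j. j \<notin> J \<longrightarrow> x j = 0}"

definition unit_vec :: "nat \<Rightarrow> nat \<Rightarrow> bit" where
  "unit_vec j = (\<lambda>i. if i = j then 1 else 0)"

definition hamming_weight :: "nat \<Rightarrow> (nat \<Rightarrow> bit) \<Rightarrow> nat" where
  "hamming_weight d x = card {j \<in> {1..d}. x j \<noteq> 0}"

definition even_class :: "nat \<Rightarrow> (nat \<Rightarrow> bit) set" where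
  "even_class d = {x \<in> cube {1..d}. even (hamming_weight d x)}"

definition odd_class :: "nat \<Rightarrow> (nat \<Rightarrow> bit) set" where
  "odd_class d = {x \<in> cube {1..d}. odd (hamming_weight d x)}"

definition adjacent :: "nat \<Rightarrow> (nat \<Rightarrow> bit) \<Rightarrow> (nat \<Rightarrow> bit) \<Rightarrow> bool" where
  "adjacent d x y \<longleftrightarrow>
     x \<in> cube {1..d} \<and> y \<in> cube {1..d} \<and> card {j \<in> {1..d}. x j \<noteq> y j} = 1"

definition open_nbhd :: "nat \<Rightarrow> (nat \<Rightarrow> bit) \<Rightarrow> (nat \<Rightarrow> bit) set" where
  "open_nbhd d x = {y. adjacent d x y}"

definition closed_nbhd :: "nat \<Rightarrow> (nat \<Rightarrow> bit) \<Rightarrow> (nat \<Rightarrow> bit) set" where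
  "closed_nbhd d x = open_nbhd d x \<union> {x}"

definition colour_class :: "nat \<Rightarrow> ((nat \<Rightarrow> bit) \<Rightarrow> nat) \<Rightarrow> nat \<Rightarrow> (nat \<Rightarrow> bit) set" where
  "colour_class d c i = {x \<in> cube {1..d}. c x = i}"

text \<open>
  Colourings are extensional functions (\<open>undefined\<close> off the vertex set), so that equality of
  colourings is equality on the vertices.
\<close>
definition surj_proper_colouring :: "nat \<Rightarrow> nat \<Rightarrow> ((nat \<Rightarrow> bit) \<Rightarrow> nat) \<Rightarrow> bool" where
  "surj_proper_colouring d q c \<longleftrightarrow>
     c \<in> cube {1..d} \<rightarrow>\<^sub>E {1..q} \<and>
     c ` cube {1..d} = {1..q} \<and>
     (\<forall>x y. adjacent d x y \<longrightarrow> c x \<noteq> c y)"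

definition pair_defensive ::
    "nat \<Rightarrow> (nat \<Rightarrow> bit) set \<Rightarrow> nat \<Rightarrow> ((nat \<Rightarrow> bit) \<Rightarrow> nat) \<Rightarrow> bool" where
  "pair_defensive d I q c \<longleftrightarrow>
     surj_proper_colouring d q c \<and>
     (\<forall>i\<in>{1..q}. \<forall>S. S \<subseteq> I \<and> card S \<le> 2 \<longrightarrow>
        (\<exists>f. f \<in> S \<rightarrow> colour_class d c i \<and> inj_on f S \<and> (\<forall>x\<in>S. f x \<in> closed_nbhd d x)))"

definition extremal ::
    "nat \<Rightarrow> (nat \<Rightarrow> bit) set \<Rightarrow> nat \<Rightarrow> ((nat \<Rightarrow> bit) \<Rightarrow> nat) \<Rightarrow> bool" where
  "extremal d I q c \<longleftrightarrow> pair_defensive d I q c \<and> q = (d + 3) div 2"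

definition link :: "nat \<Rightarrow> ((nat \<Rightarrow> bit) \<Rightarrow> nat) \<Rightarrow> (nat \<Rightarrow> bit) \<Rightarrow> nat set set" where
  "link d c b =
     {{j, l} | j l. j \<in> {1..d} \<and> l \<in> {1..d} \<and> j \<noteq> l \<and> c (b + unit_vec j + unit_vec l) = c b}"

text \<open>
  Meaningful when exactly one coordinate is uncovered by the link, which is the case for every
  extremal colouring with \<open>d = 2 * q - 3\<close> and every \<open>b\<close> in the defender parity.
\<close>
definition defect :: "nat \<Rightarrow> ((nat \<Rightarrow> bit) \<Rightarrow> nat) \<Rightarrow> (nat \<Rightarrow> bit) \<Rightarrow> nat" where
  "defect d c b = (THE j. j \<in> {1..d} \<and> j \<notin> \<Union>(link d c b))"

definition perfect_matching :: "nat set set \<Rightarrow> nat set \<Rightarrow> bool" where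
  "perfect_matching M A \<longleftrightarrow>
     (\<forall>p\<in>M. p \<subseteq> A \<and> card p = 2) \<and> pairwise disjnt M \<and> \<Union>M = A"

text \<open>
  As vectors vanish outside their index set, deleting a coordinate amounts to setting it to 0.
\<close>
definition delete_coord :: "nat \<Rightarrow> (nat \<Rightarrow> bit) \<Rightarrow> (nat \<Rightarrow> bit)" where
  "delete_coord j x = x(j := 0)"

definition transport ::
    "nat \<Rightarrow> (nat \<Rightarrow> bit) set \<Rightarrow> nat \<Rightarrow> ((nat \<Rightarrow> bit) \<Rightarrow> nat) \<Rightarrow> ((nat \<Rightarrow> bit) \<Rightarrow> nat)" where
  "transport d D j0 c =
     restrict (\<lambda>v. c (inv_into D (delete_coord j0) v)) (cube ({1..d} - {j0}))"

end

theory Submission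
  imports Defs
begin

text \<open>
  Everything rests on what an attacked vertex \<open>x\<close> sees. All \<open>q\<close> colours occur on its closed
  neighbourhood and its own colour occurs at \<open>x\<close> only, so its \<open>d = 2 * q - 3\<close> neighbours, which
  lie in \<open>D\<close>, carry exactly the other \<open>q - 1\<close> colours. As \<open>d < 2 * (q - 1)\<close>, some neighbour \<open>y\<close>
  is alone with its colour; then \<open>x\<close> has to be defended against that colour by \<open>y\<close>. A vertex of
  \<open>D\<close> can be in this position for at most one \<open>x\<close>, because for two such \<open>x\<close> no injective choice of
  defenders exists (\<open>lone_unique\<close>). Since \<open>I\<close> and \<open>D\<close> have equal size, these pairs \<open>(x, y)\<close> form a
  bijection between \<open>I\<close> and \<open>D\<close> (\<open>ex1_lone\<close>). Counting again, each attacked vertex sees one colour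
  once and the other \<open>q - 2\<close> colours exactly twice. Read from \<open>b\<close> in \<open>D\<close>, this says that the link of
  \<open>b\<close> is a perfect matching of all coordinates except the direction of its lone pair, which is
  therefore the defect coordinate (\<open>pair_defensive_splits\<close>, \<open>defect_eq\<close>).

  If that direction is always \<open>j0\<close>, then deleting \<open>j0\<close> turns a double flip avoiding \<open>j0\<close> into a
  double flip and a double flip through \<open>j0\<close> into a single flip. The link thus becomes the perfect
  matching required of \<open>\<gamma>\<close>, and the absence of \<open>j0\<close> from the link becomes properness of \<open>\<gamma>\<close>
  (\<open>reduced_iff_splits\<close>).

  Conversely, let \<open>\<gamma>\<close> satisfy both conditions and pull it back to \<open>D\<close>. The neighbours of any
  attacked vertex \<open>x\<close> other than \<open>x + unit_vec j0\<close> then come in pairs of equal colour, and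
  \<open>x + unit_vec j0\<close> has yet another colour, so exactly \<open>(d - 1) div 2 + 1 = q - 1\<close> colours are seen. The
  colouring extends to \<open>x\<close> by the one missing colour and in no other way (\<open>extremal_extension\<close>,
  \<open>pair_defensive_eqI\<close>). The result is pair-defensive because two attacked vertices could only
  compete for a single defender along the same direction \<open>j0\<close>, and would then coincide
  (\<open>splits_extremal\<close>).
\<close>

section \<open>Fibres and matchings\<close>

lemma card_eq_sum_card_fibres:
  assumes "finite A"
  shows "card A = (\<Sum>y\<in>h ` A. card {a \<in> A. h a = y})"
  using sum.image_gen[OF assms, of "\<lambda>_. 1::nat" h] by simp

lemma ex1_other_iff_card_fibre:
  assumes "finite A" "j \<in> A"
  shows "(\<exists>!l. l \<in> A \<and> l \<noteq> j \<and> h l = h j) \<longleftrightarrow> card {a \<in> A. h a = h j} = 2"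
proof -
  have "{a \<in> A. h a = h j} = insert j {l \<in> A. l \<noteq> j \<and> h l = h j}"
    using assms by auto
  moreover have "finite {l \<in> A. l \<noteq> j \<and> h l = h j}"
    using assms by simp
  ultimately have "card {a \<in> A. h a = h j} = Suc (card {l \<in> A. l \<noteq> j \<and> h l = h j})"
    by (simp add: card_insert_if)
  then have "card {a \<in> A. h a = h j} = 2 \<longleftrightarrow> card {l \<in> A. l \<noteq> j \<and> h l = h j} = 1"
    by simp
  also have "\<dots> \<longleftrightarrow> (\<exists>!l. l \<in> A \<and> l \<noteq> j \<and> h l = h j)"
    unfolding One_nat_def card_1_singleton_iff set_eq_iff mem_Collect_eq singleton_iff Ex1_def
    by blast
  finally show ?thesis by simp
qed

lemma card_image_if_fibres_two:
  assumes "finite A" "\<And>j. j \<in> A \<Longrightarrow> \<exists>!l. l \<in> A \<and> l \<noteq> j \<and> h l = h j"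
  shows "card A = 2 * card (h ` A)"
proof -
  have "card {a \<in> A. h a = y} = 2" if "y \<in> h ` A" for y
    using that assms(2) by (auto simp flip: ex1_other_iff_card_fibre[OF assms(1)])
  then show ?thesis
    by (subst card_eq_sum_card_fibres[OF assms(1), of h]) simp
qed

lemma exists_singleton_fibre:
  assumes "finite A" "card A < 2 * card (h ` A)"
  shows "\<exists>j\<in>A. \<forall>l\<in>A. h l = h j \<longrightarrow> l = j"
proof (rule ccontr)
  assume no: "\<not> ?thesis"
  have "2 \<le> card {a \<in> A. h a = y}" if y: "y \<in> h ` A" for y
  proof -
    obtain j where j: "j \<in> A" "y = h j" using y by auto
    with no obtain l where "l \<in> A" "h l = h j" "l \<noteq> j" by blast
    with j have "{j, l} \<subseteq> {a \<in> A. h a = y}" "card {j, l} = 2" by auto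
    then show ?thesis
      using card_mono[of "{a \<in> A. h a = y}" "{j, l}"] assms(1) by simp
  qed
  then have "(\<Sum>y\<in>h ` A. 2) \<le> (\<Sum>y\<in>h ` A. card {a \<in> A. h a = y})"
    by (rule sum_mono)
  then show False
    using assms card_eq_sum_card_fibres[OF assms(1), of h] by simp
qed

text \<open>
  All fibres except that of \<open>s\<close> have at least two elements, and \<open>card A\<close> leaves no room for a
  third one in any of them.
\<close>
lemma other_fibres_two:
  assumes fin: "finite A" and card: "card A + 1 = 2 * card (h ` A)"
    and s: "s \<in> A" "\<And>j. j \<in> A \<Longrightarrow> \<forall>l\<in>A. h l = h j \<longrightarrow> l = j \<Longrightarrow> j = s"
    and j: "j \<in> A" "j \<noteq> s"
  shows "\<exists>!l. l \<in> A \<and> l \<noteq> j \<and> h l = h j"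
proof -
  let ?F = "\<lambda>y. {a \<in> A. h a = y}"
  have ge: "2 \<le> card (?F y)" if y: "y \<in> h ` A" "y \<noteq> h s" for y
  proof -
    obtain k where k: "k \<in> A" "y = h k" using y by auto
    with y s obtain l where "l \<in> A" "h l = h k" "l \<noteq> k" by blast
    with k have "{k, l} \<subseteq> ?F y" "card {k, l} = 2" by auto
    then show ?thesis using card_mono[of "?F y" "{k, l}"] fin by simp
  qed
  have sing: "?F (h s) = {s}"
  proof -
    obtain t where t: "t \<in> A" "\<forall>l\<in>A. h l = h t \<longrightarrow> l = t"
      using exists_singleton_fibre[OF fin, of h] card by auto
    then have "t = s" using s(2) by blast
    with t show ?thesis by auto
  qed
  have "card A = card (?F (h s)) + (\<Sum>y\<in>h ` A - {h s}. card (?F y))"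
    using fin s(1) sum.remove[of "h ` A" "h s" "\<lambda>y. card (?F y)"]
    by (simp add: card_eq_sum_card_fibres[OF fin, of h])
  then have eq: "card A = 1 + (\<Sum>y\<in>h ` A - {h s}. card (?F y))"
    by (simp add: sing)
  have "h j \<noteq> h s" using sing j by auto
  then have hj: "h j \<in> h ` A - {h s}" using j by simp
  have "(\<Sum>y\<in>h ` A - {h s}. card (?F y)) = (\<Sum>y\<in>h ` A - {h s}. 2)"
    using eq card s(1) fin by (simp add: card_Diff_singleton_if)
  then have "card (?F (h j)) = 2"
    using sum_mono_inv[of "\<lambda>_. 2::nat" "h ` A - {h s}" "\<lambda>y. card (?F y)" "h j"] ge hj fin
    by simp
  then show ?thesis using ex1_other_iff_card_fibre[OF fin j(1), of h] by simp
qed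

text \<open>
  Both the link and the matching required of \<open>\<gamma>\<close> have this shape. The partner form on the
  right is the one in which counting colours on a neighbourhood produces and consumes matchings.
\<close>
lemma perfect_matching_pairs_iff:
  assumes sym: "\<And>j l. R j l \<Longrightarrow> R l j"
  shows "perfect_matching {{j, l} | j l. j \<in> A \<and> l \<in> A \<and> j \<noteq> l \<and> R j l} A \<longleftrightarrow>
    (\<forall>j\<in>A. \<exists>!l. l \<in> A \<and> l \<noteq> j \<and> R j l)" (is "perfect_matching ?M A \<longleftrightarrow> ?E")
proof -
  \<comment> \<open>Naming the matching hides the comprehension from the classical reasoner.\<close>
  define M where "M = ?M"
  have pair: "{j, l} \<in> M" if "j \<in> A" "l \<in> A" "l \<noteq> j" "R j l" for j l
    using that unfolding M_def by blast
  have sets: "p \<subseteq> A \<and> card p = 2" if "p \<in> M" for p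
    using that unfolding M_def by auto
  have partner: "\<exists>l. p = {a, l} \<and> l \<in> A \<and> l \<noteq> a \<and> R a l" if "p \<in> M" "a \<in> p" for p a
    using that sym unfolding M_def by (auto simp: insert_commute)
  have "perfect_matching M A \<longleftrightarrow> ?E"
  proof
    assume "perfect_matching M A"
    then have disj: "pairwise disjnt M" and cover: "\<Union>M = A"
      unfolding perfect_matching_def by blast+
    show ?E
    proof
      fix j assume j: "j \<in> A"
      with cover obtain p where "p \<in> M" "j \<in> p" by blast
      with partner obtain l where l: "l \<in> A" "l \<noteq> j" "R j l" by blast
      have "m = l" if m: "m \<in> A" "m \<noteq> j" "R j m" for m
      proof -
        have "{j, l} \<in> M" "{j, m} \<in> M" using j l m pair by blast+
        moreover have "\<not> disjnt {j, l} {j, m}" by (simp add: disjnt_def)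
        ultimately have "{j, l} = {j, m}" using pairwiseD[OF disj] by blast
        then show ?thesis using l m by (simp add: doubleton_eq_iff)
      qed
      with l show "\<exists>!l. l \<in> A \<and> l \<noteq> j \<and> R j l" by blast
    qed
  next
    assume E: ?E
    have "disjnt p p'" if p: "p \<in> M" "p' \<in> M" "p \<noteq> p'" for p p'
    proof (rule ccontr)
      assume "\<not> disjnt p p'"
      then obtain a where a: "a \<in> p" "a \<in> p'" unfolding disjnt_def by blast
      then have "a \<in> A" using p(1) sets by blast
      with E have ex1: "\<exists>!l. l \<in> A \<and> l \<noteq> a \<and> R a l" by (rule bspec)
      obtain l where l: "p = {a, l}" "l \<in> A \<and> l \<noteq> a \<and> R a l" using partner[OF p(1) a(1)] by blast
      obtain m where m: "p' = {a, m}" "m \<in> A \<and> m \<noteq> a \<and> R a m" using partner[OF p(2) a(2)] by blast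
      have "l = m" by (rule ex1E[OF ex1]) (use l(2) m(2) in metis)
      with l m p(3) show False by simp
    qed
    then have "pairwise disjnt M" by (rule pairwiseI)
    moreover have "\<Union>M = A"
    proof
      show "\<Union>M \<subseteq> A" using sets by blast
      show "A \<subseteq> \<Union>M"
      proof
        fix j assume j: "j \<in> A"
        with E obtain l where "l \<in> A" "l \<noteq> j" "R j l" by blast
        with j pair have "{j, l} \<in> M" by blast
        then show "j \<in> \<Union>M" by blast
      qed
    qed
    ultimately show "perfect_matching M A"
      unfolding perfect_matching_def using sets by blast
  qed
  then show ?thesis unfolding M_def .
qed

section \<open>The cube and its parity classes\<close>

text \<open>
  The set of coordinates should stay \<open>{1..d}\<close> and be handled as a set, rather than be rewritten
  to \<open>{Suc 0..d}\<close> and to inequalities.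
\<close>
declare One_nat_def [simp del] atLeastAtMost_iff [simp del]

lemma bit_vec_add_self [simp]: "x + x = (0 :: nat \<Rightarrow> bit)"
  by (rule ext) simp

lemma add_unit_vec_twice [simp]: "x + unit_vec j + unit_vec j = x"
  by (simp add: add.assoc)

lemma add_unit_vec_commute: "x + unit_vec j + unit_vec l = x + unit_vec l + unit_vec j"
  by (simp add: ac_simps)

lemma add_unit_vec_cancel [simp]: "x + unit_vec j + unit_vec l + unit_vec j = x + unit_vec l"
  by (metis add_unit_vec_commute add_unit_vec_twice)

lemma unit_vec_inject [simp]: "unit_vec j = unit_vec l \<longleftrightarrow> j = l"
  by (auto simp: unit_vec_def fun_eq_iff split: if_splits)

lemma cube_add_unit_vec [simp]: "j \<in> J \<Longrightarrow> x + unit_vec j \<in> cube J \<longleftrightarrow> x \<in> cube J"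
  by (auto simp: cube_def unit_vec_def)

lemma finite_cube:
  assumes "finite J"
  shows "finite (cube J)"
proof (rule finite_subset)
  show "finite {x. \<forall>j. (j \<in> J \<longrightarrow> x j \<in> {0, 1 :: bit}) \<and> (j \<notin> J \<longrightarrow> x j = 0)}"
    by (rule finite_set_of_finite_funs) (use assms in auto)
qed (auto simp: cube_def)

lemma adjacent_iff: "adjacent d x y \<longleftrightarrow> x \<in> cube {1..d} \<and> (\<exists>j\<in>{1..d}. y = x + unit_vec j)"
proof
  assume adj: "adjacent d x y"
  then obtain j where j: "{i \<in> {1..d}. x i \<noteq> y i} = {j}"
    unfolding adjacent_def One_nat_def card_1_singleton_iff by blast
  then have "x j \<noteq> y j" "\<And>i. i \<noteq> j \<Longrightarrow> x i = y i"
    using adj unfolding adjacent_def cube_def by (blast, force)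
  then have "y i = (x + unit_vec j) i" for i
    by (cases "i = j"; cases "x i"; cases "y i") (auto simp: unit_vec_def)
  with j adj show "x \<in> cube {1..d} \<and> (\<exists>j\<in>{1..d}. y = x + unit_vec j)"
    unfolding adjacent_def by blast
next
  assume "x \<in> cube {1..d} \<and> (\<exists>j\<in>{1..d}. y = x + unit_vec j)"
  then obtain j where x: "x \<in> cube {1..d}" and j: "j \<in> {1..d}" "y = x + unit_vec j" by blast
  then have "{i \<in> {1..d}. x i \<noteq> y i} = {j}" by (auto simp: unit_vec_def)
  with x j show "adjacent d x y" unfolding adjacent_def by simp
qed

text \<open>
  In \<open>bit\<close> the parity of the weight is the sum of the coordinates, and additivity of the sum shows
  how a flip changes it.
\<close>
lemma even_hamming_weight_iff: "even (hamming_weight d x) \<longleftrightarrow> (\<Sum>j\<in>{1..d}. x j) = 0"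
proof -
  have "(\<Sum>j\<in>{1..d}. x j) = (\<Sum>j\<in>{j \<in> {1..d}. x j \<noteq> 0}. x j)"
    by (rule sum.mono_neutral_right) auto
  also have "\<dots> = (\<Sum>j\<in>{j \<in> {1..d}. x j \<noteq> 0}. 1)"
    by (rule sum.cong) auto
  also have "\<dots> = of_nat (hamming_weight d x)"
    by (simp add: hamming_weight_def)
  finally have "(\<Sum>j\<in>{1..d}. x j) = of_nat (hamming_weight d x)" .
  moreover have "even n \<longleftrightarrow> (of_nat n :: bit) = 0" for n
    by (induction n) auto
  ultimately show ?thesis by simp
qed

lemma sum_add_unit_vec:
  assumes "j \<in> {1..d}"
  shows "(\<Sum>i\<in>{1..d}. (x + unit_vec j) i) = (\<Sum>i\<in>{1..d}. x i) + 1"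
proof -
  have "(\<Sum>i\<in>{1..d}. unit_vec j i) = 1" using assms by (simp add: unit_vec_def)
  then show ?thesis by (simp only: plus_fun_apply sum.distrib)
qed

lemma delete_coord_add_unit_vec:
  assumes "j \<noteq> j0"
  shows "delete_coord j0 (x + unit_vec j) = delete_coord j0 x + unit_vec j"
  using assms by (auto simp: delete_coord_def unit_vec_def fun_eq_iff)

lemma delete_coord_add_same: "delete_coord j0 (x + unit_vec j0) = delete_coord j0 x"
  by (auto simp: delete_coord_def unit_vec_def fun_eq_iff)

locale parity_classes =
  fixes d :: nat and I D :: "(nat \<Rightarrow> bit) set"
  assumes classes: "I = even_class d \<and> D = odd_class d \<or> I = odd_class d \<and> D = even_class d"
begin

text \<open>
  This treats the two assignments of the parity classes to \<open>I\<close> and \<open>D\<close> uniformly.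
\<close>
lemma obtain_parity:
  obtains p where "I = {x \<in> cube {1..d}. (\<Sum>j\<in>{1..d}. x j) = p}"
    "D = {x \<in> cube {1..d}. (\<Sum>j\<in>{1..d}. x j) = p + 1}"
proof -
  have "even_class d = {x \<in> cube {1..d}. (\<Sum>j\<in>{1..d}. x j) = 0}"
    "odd_class d = {x \<in> cube {1..d}. (\<Sum>j\<in>{1..d}. x j) = 1}"
    by (auto simp: even_class_def odd_class_def even_hamming_weight_iff)
  with classes that[of 0] that[of 1] show thesis by auto
qed

lemma cube_eq: "cube {1..d} = I \<union> D"
  using classes by (auto simp: even_class_def odd_class_def)

lemma I_D_disjoint: "x \<in> I \<Longrightarrow> x \<notin> D"
  using classes by (auto simp: even_class_def odd_class_def)

lemma finite_I: "finite I" and finite_D: "finite D"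
  using finite_cube[of "{1..d}"] by (simp_all add: cube_eq)

lemma flip_in_D [simp]: "j \<in> {1..d} \<Longrightarrow> x + unit_vec j \<in> D \<longleftrightarrow> x \<in> I"
  by (rule obtain_parity) (auto simp: sum_add_unit_vec simp del: plus_fun_apply)

lemma flip_in_I [simp]: "j \<in> {1..d} \<Longrightarrow> x + unit_vec j \<in> I \<longleftrightarrow> x \<in> D"
  using flip_in_D[of j "x + unit_vec j"] by simp

lemma card_I_eq_card_D:
  assumes "j \<in> {1..d}"
  shows "card I = card D"
proof (rule bij_betw_same_card)
  show "bij_betw (\<lambda>x. x + unit_vec j) I D"
    by (rule bij_betwI[where g = "\<lambda>x. x + unit_vec j"]) (use assms in auto)
qed

text \<open>
  The fibres of \<open>delete_coord j0\<close> are the pairs of endpoints of edges in direction \<open>j0\<close>, and each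
  edge has exactly one end in \<open>D\<close>.
\<close>
lemma bij_delete_coord:
  assumes j0: "j0 \<in> {1..d}"
  shows "bij_betw (delete_coord j0) D (cube ({1..d} - {j0}))"
proof (rule bij_betw_imageI)
  have split: "x = delete_coord j0 x \<or> x = delete_coord j0 x + unit_vec j0" for x
    by (cases "x j0") (auto simp: delete_coord_def unit_vec_def fun_eq_iff)
  show "inj_on (delete_coord j0) D"
  proof (rule inj_onI)
    fix x y assume xy: "x \<in> D" "y \<in> D" "delete_coord j0 x = delete_coord j0 y"
    then have "x = y \<or> x = y + unit_vec j0 \<or> y = x + unit_vec j0"
      using split[of x] split[of y] by metis
    then show "x = y" using xy j0 flip_in_D I_D_disjoint by blast
  qed
  show "delete_coord j0 ` D = cube ({1..d} - {j0})"
  proof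
    show "delete_coord j0 ` D \<subseteq> cube ({1..d} - {j0})"
    proof
      fix v assume "v \<in> delete_coord j0 ` D"
      then obtain b where "b \<in> cube {1..d}" "v = delete_coord j0 b" using cube_eq by blast
      then show "v \<in> cube ({1..d} - {j0})" by (auto simp: delete_coord_def cube_def)
    qed
    show "cube ({1..d} - {j0}) \<subseteq> delete_coord j0 ` D"
    proof
      fix v assume v: "v \<in> cube ({1..d} - {j0})"
      then have del: "delete_coord j0 v = v" by (auto simp: delete_coord_def cube_def)
      have "v \<in> I \<union> D" unfolding cube_eq[symmetric] using v by (auto simp: cube_def)
      then consider "v \<in> D" | "v + unit_vec j0 \<in> D" using j0 by auto
      then show "v \<in> delete_coord j0 ` D"
        by cases (metis del delete_coord_add_same imageI)+
    qed
  qed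
qed

lemma transport_delete_coord:
  assumes "j0 \<in> {1..d}" "b \<in> D"
  shows "transport d D j0 c (delete_coord j0 b) = c b"
proof -
  note bij = bij_delete_coord[OF assms(1)]
  have "delete_coord j0 b \<in> cube ({1..d} - {j0})"
    using bij assms(2) by (auto simp: bij_betw_def)
  then show ?thesis
    using bij_betw_inv_into_left[OF bij assms(2)] by (simp add: transport_def)
qed

section \<open>Lone neighbours and the structure of links\<close>

text \<open>
  This says that the link of \<open>b\<close> is a perfect matching of the coordinates other than \<open>\<delta>\<close>. It is
  stated through flips because that form translates directly into colour multiplicities around a
  vertex of \<open>I\<close>: for \<open>x = b + unit_vec j\<close>, it compares the colours of two neighbours of \<open>x\<close>.
\<close>
definition splits_at :: "((nat \<Rightarrow> bit) \<Rightarrow> nat) \<Rightarrow> (nat \<Rightarrow> bit) \<Rightarrow> nat \<Rightarrow> bool" where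
  "splits_at c b \<delta> \<longleftrightarrow>
     (\<forall>j\<in>{1..d} - {\<delta>}. c (b + unit_vec \<delta> + unit_vec j) \<noteq> c b) \<and>
     (\<forall>j\<in>{1..d} - {\<delta>}.
        \<exists>!l. l \<in> {1..d} - {\<delta>} \<and> l \<noteq> j \<and> c (b + unit_vec j + unit_vec l) = c b)"

text \<open>
  In a proper colouring the neighbour of \<open>x\<close> in direction \<open>j\<close> is then the only possible defender
  of \<open>x\<close> against its colour.
\<close>
definition lone :: "((nat \<Rightarrow> bit) \<Rightarrow> nat) \<Rightarrow> (nat \<Rightarrow> bit) \<Rightarrow> nat \<Rightarrow> bool" where
  "lone c x j \<longleftrightarrow> (\<forall>l\<in>{1..d}. c (x + unit_vec l) = c (x + unit_vec j) \<longrightarrow> l = j)"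

lemma link_perfect_matching:
  assumes "splits_at c b \<delta>"
  shows "perfect_matching (link d c b) ({1..d} - {\<delta>})"
proof -
  let ?A = "{1..d} - {\<delta>}"
  have "j \<noteq> \<delta> \<and> l \<noteq> \<delta>"
    if "j \<in> {1..d}" "l \<in> {1..d}" "j \<noteq> l" "c (b + unit_vec j + unit_vec l) = c b" for j l
    using assms that unfolding splits_at_def by (metis Diff_iff add_unit_vec_commute singletonD)
  then have "link d c b =
      {{j, l} | j l. j \<in> ?A \<and> l \<in> ?A \<and> j \<noteq> l \<and> c (b + unit_vec j + unit_vec l) = c b}"
    unfolding link_def by blast
  moreover have "perfect_matching \<dots> ?A"
    by (subst perfect_matching_pairs_iff)
      (use assms in \<open>auto simp: splits_at_def add_unit_vec_commute\<close>)
  ultimately show ?thesis by simp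
qed

lemma defect_eq:
  assumes "splits_at c b \<delta>" "\<delta> \<in> {1..d}"
  shows "defect d c b = \<delta>"
proof -
  have "\<Union>(link d c b) = {1..d} - {\<delta>}"
    using link_perfect_matching[OF assms(1)] unfolding perfect_matching_def by blast
  then have "j \<in> {1..d} \<and> j \<notin> \<Union>(link d c b) \<longleftrightarrow> j = \<delta>" for j
    using assms(2) by blast
  then show ?thesis unfolding defect_def by simp
qed

lemma proper_flip:
  assumes "pair_defensive d I q c" "x \<in> cube {1..d}" "j \<in> {1..d}"
  shows "c (x + unit_vec j) \<noteq> c x"
proof -
  have "adjacent d x (x + unit_vec j)" unfolding adjacent_iff using assms by blast
  with assms(1) show ?thesis unfolding pair_defensive_def surj_proper_colouring_def by metis
qed

lemma colour_in_range:
  assumes "pair_defensive d I q c" "x \<in> cube {1..d}"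
  shows "c x \<in> {1..q}"
  using assms unfolding pair_defensive_def surj_proper_colouring_def by blast

lemma defender_flip:
  assumes pd: "pair_defensive d I q c" and x: "x \<in> I" and i: "i \<noteq> c x"
    and y: "y \<in> colour_class d c i" "y \<in> closed_nbhd d x"
  obtains j where "j \<in> {1..d}" "y = x + unit_vec j" "c y = i"
  using assms that by (auto simp: closed_nbhd_def open_nbhd_def colour_class_def adjacent_iff)

text \<open>
  Applying the defence condition to single vertices shows that every colour other than \<open>c x\<close>
  occurs next to \<open>x\<close>; properness excludes \<open>c x\<close> itself.
\<close>
lemma neighbour_colours:
  assumes pd: "pair_defensive d I q c" and x: "x \<in> I"
  shows "(\<lambda>j. c (x + unit_vec j)) ` {1..d} = {1..q} - {c x}"
proof
  have xc: "x \<in> cube {1..d}" using x by (simp add: cube_eq)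
  show "(\<lambda>j. c (x + unit_vec j)) ` {1..d} \<subseteq> {1..q} - {c x}"
    using proper_flip[OF pd xc] colour_in_range[OF pd] xc by auto
  show "{1..q} - {c x} \<subseteq> (\<lambda>j. c (x + unit_vec j)) ` {1..d}"
  proof
    fix i assume i: "i \<in> {1..q} - {c x}"
    have "\<exists>f. f \<in> {x} \<rightarrow> colour_class d c i \<and> inj_on f {x} \<and> (\<forall>x\<in>{x}. f x \<in> closed_nbhd d x)"
      using pd i x unfolding pair_defensive_def
      by (elim conjE) (drule bspec[of _ _ i], simp, drule spec[of _ "{x}"], simp)
    then obtain y where "y \<in> colour_class d c i" "y \<in> closed_nbhd d x" by auto
    then show "i \<in> (\<lambda>j. c (x + unit_vec j)) ` {1..d}"
      using i by (elim defender_flip[OF pd x, rotated]) auto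
  qed
qed

lemma card_neighbour_colours:
  assumes "pair_defensive d I q c" "x \<in> I"
  shows "card ((\<lambda>j. c (x + unit_vec j)) ` {1..d}) = q - 1"
  using assms colour_in_range[of q c x] by (simp add: neighbour_colours cube_eq)

text \<open>
  This is where pairs matter. If \<open>b\<close> were a lone neighbour in two directions, both
  \<open>b + unit_vec i\<close> and \<open>b + unit_vec j\<close> could only be defended against the colour of \<open>b\<close> by \<open>b\<close>,
  contradicting injectivity.
\<close>
lemma lone_unique:
  assumes pd: "pair_defensive d I q c" and b: "b \<in> D"
    and i: "i \<in> {1..d}" "lone c (b + unit_vec i) i"
    and j: "j \<in> {1..d}" "lone c (b + unit_vec j) j"
  shows "i = j"
proof (rule ccontr)
  assume neq: "i \<noteq> j"
  have bc: "b \<in> cube {1..d}" using b by (simp add: cube_eq)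
  let ?S = "{b + unit_vec i, b + unit_vec j}"
  have "?S \<subseteq> I" "card ?S \<le> 2" using b i j by (auto simp: card_insert_if)
  then obtain f where f: "f \<in> ?S \<rightarrow> colour_class d c (c b)" "inj_on f ?S"
      "\<forall>x\<in>?S. f x \<in> closed_nbhd d x"
    using pd colour_in_range[OF pd bc] unfolding pair_defensive_def by meson
  have to_b: "f (b + unit_vec k) = b"
    if k: "k \<in> {1..d}" "lone c (b + unit_vec k) k" "b + unit_vec k \<in> ?S" for k
  proof -
    have xI: "b + unit_vec k \<in> I" using b k by simp
    have nc: "c b \<noteq> c (b + unit_vec k)" using proper_flip[OF pd bc k(1)] by simp
    have y: "f (b + unit_vec k) \<in> colour_class d c (c b)"
        "f (b + unit_vec k) \<in> closed_nbhd d (b + unit_vec k)"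
      using f k(3) by auto
    obtain l where l: "l \<in> {1..d}" "f (b + unit_vec k) = b + unit_vec k + unit_vec l"
        "c (f (b + unit_vec k)) = c b"
      by (rule defender_flip[OF pd xI nc y])
    then have "l = k" using k(2) unfolding lone_def by auto
    with l show ?thesis by simp
  qed
  have "f (b + unit_vec i) = f (b + unit_vec j)" using to_b i j by simp
  then have "b + unit_vec i = b + unit_vec j" by (rule inj_onD[OF f(2)]) simp_all
  with neq show False by simp
qed

text \<open>
  Double counting of the lone pairs \<open>P\<close>. Each \<open>x\<close> in \<open>I\<close> has at least one, as it sees \<open>q - 1\<close> colours
  on \<open>2 * q - 3\<close> neighbours, and each vertex of \<open>D\<close> is in at most one by \<open>lone_unique\<close>. As
  \<open>card I = card D\<close>, both bounds are attained, so \<open>P\<close> is a perfect pairing of \<open>I\<close> with \<open>D\<close>.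
\<close>
lemma ex1_lone:
  assumes pd: "pair_defensive d I q c" and d: "d + 3 = 2 * q"
  shows "x \<in> I \<Longrightarrow> \<exists>!j. j \<in> {1..d} \<and> lone c x j"
    and "b \<in> D \<Longrightarrow> \<exists>j\<in>{1..d}. lone c (b + unit_vec j) j"
proof -
  define P where "P = {(x, j). x \<in> I \<and> j \<in> {1..d} \<and> lone c x j}"
  have finP: "finite P"
    by (rule finite_subset[of _ "I \<times> {1..d}"]) (auto simp: P_def finite_I)
  have fst: "fst ` P = I"
  proof
    show "fst ` P \<subseteq> I" by (auto simp: P_def)
    show "I \<subseteq> fst ` P"
    proof
      fix x assume x: "x \<in> I"
      then have "card ((\<lambda>j. c (x + unit_vec j)) ` {1..d}) = q - 1"
        by (rule card_neighbour_colours[OF pd])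
      then have "\<exists>j\<in>{1..d}. lone c x j"
        unfolding lone_def by (intro exists_singleton_fibre) (use d in auto)
      with x show "x \<in> fst ` P" by (force simp: P_def)
    qed
  qed
  let ?g = "\<lambda>(x, j). x + unit_vec j"
  have inj: "inj_on ?g P"
  proof (rule inj_onI, clarify)
    fix x i y j assume xi: "(x, i) \<in> P" and yj: "(y, j) \<in> P"
      and eq: "x + unit_vec i = y + unit_vec j"
    have "x + unit_vec i \<in> D" using xi by (auto simp: P_def)
    moreover have x: "x = x + unit_vec i + unit_vec i" by simp
    moreover have y: "y = x + unit_vec i + unit_vec j" by (simp add: eq)
    ultimately have "i = j"
      using lone_unique[OF pd, of "x + unit_vec i" i j] xi yj by (auto simp: P_def)
    with x y show "x = y \<and> i = j" by simp
  qed
  have "d \<noteq> 0" using d by presburger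
  then have "1 \<in> {1..d}" by (simp add: atLeastAtMost_iff)
  then have card: "card I = card D" by (rule card_I_eq_card_D)
  have sub: "?g ` P \<subseteq> D" by (auto simp: P_def)
  have "card P = card (?g ` P)" using inj by (simp add: card_image)
  also have "\<dots> \<le> card D" using sub finite_D by (rule card_mono[rotated])
  finally have "card P \<le> card I" by (simp add: card)
  moreover have "card I \<le> card P" using card_image_le[OF finP, of fst] by (simp add: fst)
  ultimately have cardP: "card P = card I" by simp
  then have inj_fst: "inj_on fst P" using finP fst by (intro eq_card_imp_inj_on) auto
  show "\<exists>!j. j \<in> {1..d} \<and> lone c x j" if "x \<in> I" for x
  proof -
    from that fst obtain j where j: "(x, j) \<in> P" by fastforce
    have "i = j" if "(x, i) \<in> P" for i
      using inj_onD[OF inj_fst, of "(x, i)" "(x, j)"] j that by simp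
    with j \<open>x \<in> I\<close> show ?thesis by (auto simp: P_def)
  qed
  have "?g ` P = D"
    using sub finite_D cardP card inj by (intro card_subset_eq) (auto simp: card_image)
  then show "\<exists>j\<in>{1..d}. lone c (b + unit_vec j) j" if "b \<in> D" for b
  proof -
    from that \<open>?g ` P = D\<close> obtain x j where "(x, j) \<in> P" "b = x + unit_vec j" by force
    then show ?thesis by (intro bexI[of _ j]) (auto simp: P_def)
  qed
qed

text \<open>
  The direction \<open>\<delta>\<close> is that of the lone pair of \<open>b\<close>. For any other \<open>j\<close> the vertex
  \<open>b + unit_vec j\<close> has its lone neighbour elsewhere, so it sees the colour of \<open>b\<close> exactly twice:
  at \<open>b\<close> and at one further neighbour, whose direction is the partner of \<open>j\<close>.
\<close>
lemma pair_defensive_splits: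
  assumes pd: "pair_defensive d I q c" and d: "d + 3 = 2 * q" and b: "b \<in> D"
  shows "\<exists>\<delta>\<in>{1..d}. splits_at c b \<delta>"
proof -
  obtain s where s: "s \<in> {1..d}" "lone c (b + unit_vec s) s"
    using ex1_lone(2)[OF pd d b] by blast
  have away: "c (b + unit_vec s + unit_vec j) \<noteq> c b" if "j \<in> {1..d} - {s}" for j
    using s(2) that by (auto simp: lone_def)
  have ex1: "\<exists>!l. l \<in> {1..d} - {s} \<and> l \<noteq> j \<and> c (b + unit_vec j + unit_vec l) = c b"
    if j: "j \<in> {1..d} - {s}" for j
  proof -
    let ?x = "b + unit_vec j"
    have x: "?x \<in> I" using b j by simp
    then have card: "card ((\<lambda>j. c (?x + unit_vec j)) ` {1..d}) = q - 1"
      by (rule card_neighbour_colours[OF pd])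
    obtain t where t: "t \<in> {1..d}" "lone c ?x t"
        and t_uniq: "\<And>i. i \<in> {1..d} \<Longrightarrow> lone c ?x i \<Longrightarrow> i = t"
      using ex1_lone(1)[OF pd d x] by blast
    have "j \<noteq> t"
      using lone_unique[OF pd b, of j s] s t(2) j by blast
    then have "\<exists>!l. l \<in> {1..d} \<and> l \<noteq> j \<and> c (?x + unit_vec l) = c (?x + unit_vec j)"
    proof (intro other_fibres_two)
      show "card {1..d} + 1 = 2 * card ((\<lambda>j. c (?x + unit_vec j)) ` {1..d})"
        using d by (simp add: card)
      show "i = t"
        if "i \<in> {1..d}" "\<forall>l\<in>{1..d}. c (?x + unit_vec l) = c (?x + unit_vec i) \<longrightarrow> l = i" for i
        using t_uniq that by (simp add: lone_def)
    qed (use t j in auto)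
    then have ex: "\<exists>!l. l \<in> {1..d} \<and> l \<noteq> j \<and> c (?x + unit_vec l) = c b" by simp
    \<comment> \<open>The partner of \<open>j\<close> is not \<open>s\<close>.\<close>
    have "c (?x + unit_vec s) \<noteq> c b" using away[OF j] by (simp add: add_unit_vec_commute)
    then have "l \<in> {1..d} - {s} \<and> l \<noteq> j \<and> c (?x + unit_vec l) = c b \<longleftrightarrow>
        l \<in> {1..d} \<and> l \<noteq> j \<and> c (?x + unit_vec l) = c b" for l
      by auto
    with ex show ?thesis by (simp only:)
  qed
  have "splits_at c b s"
    unfolding splits_at_def by (intro conjI ballI away ex1)
  with s(1) show ?thesis by (rule bexI[rotated])
qed

section \<open>Colourings with constant defect\<close>

text \<open>
  Directions other than \<open>j0\<close> contribute \<open>(d - 1) div 2\<close> colours, each seen twice, and direction \<open>j0\<close>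
  contributes one more. Only values of \<open>c\<close> on \<open>D\<close> enter, so this holds before a colouring of \<open>I\<close> has
  been chosen; if the colours come from \<open>{1..q}\<close>, exactly one of them is left for \<open>x\<close>.
\<close>
lemma card_neighbour_colours_if_splits:
  assumes d: "d + 3 = 2 * q" and j0: "j0 \<in> {1..d}"
    and sp: "\<And>b. b \<in> D \<Longrightarrow> splits_at c b j0" and x: "x \<in> I"
  shows "card ((\<lambda>j. c (x + unit_vec j)) ` {1..d}) = q - 1"
proof -
  let ?A = "{1..d} - {j0}" and ?h = "\<lambda>j. c (x + unit_vec j)"
  have "\<exists>!l. l \<in> ?A \<and> l \<noteq> j \<and> ?h l = ?h j" if j: "j \<in> ?A" for j
  proof -
    have "splits_at c (x + unit_vec j) j0" using sp j x by simp
    then have "\<exists>!l. l \<in> ?A \<and> l \<noteq> j \<and> c (x + unit_vec j + unit_vec j + unit_vec l) = ?h j"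
      using j unfolding splits_at_def by blast
    then show ?thesis by (simp only: add_unit_vec_twice)
  qed
  then have "card ?A = 2 * card (?h ` ?A)" by (intro card_image_if_fibres_two) auto
  moreover have "card ?A = d - 1" using j0 by simp
  moreover have "?h j0 \<notin> ?h ` ?A"
    using sp[of "x + unit_vec j0"] x j0 unfolding splits_at_def by auto
  moreover have "?h ` {1..d} = insert (?h j0) (?h ` ?A)"
    using j0 by auto
  ultimately show ?thesis using d by simp
qed

lemma lone_eq_if_splits:
  assumes sp: "splits_at c b j0" and j: "j \<in> {1..d}" "lone c (b + unit_vec j) j"
  shows "j = j0"
proof (rule ccontr)
  assume "j \<noteq> j0"
  with sp j(1) obtain l where "l \<in> {1..d}" "l \<noteq> j" "c (b + unit_vec j + unit_vec l) = c b"
    unfolding splits_at_def by blast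
  with j(2) show False unfolding lone_def by auto
qed

text \<open>
  If \<open>y\<close> were the neighbour of \<open>x\<close> in another direction \<open>j\<close>, then \<open>j\<close> would have a partner \<open>l\<close> in the
  matching at \<open>y\<close>, and \<open>x + unit_vec l\<close> would be a second defender of \<open>x\<close>.
\<close>
lemma sole_defender:
  assumes sp: "\<And>b. b \<in> D \<Longrightarrow> splits_at c b j0" and x: "x \<in> I"
    and y: "y \<in> colour_class d c i" "y \<in> closed_nbhd d x" "y \<noteq> x"
    and sole: "\<And>z. z \<in> colour_class d c i \<Longrightarrow> z \<in> closed_nbhd d x \<Longrightarrow> z = y"
  shows "y \<in> D \<and> x = y + unit_vec j0"
proof -
  obtain j where j: "j \<in> {1..d}" and y_eq: "y = x + unit_vec j"
    using y by (auto simp: closed_nbhd_def open_nbhd_def adjacent_iff)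
  have "l = j" if l: "l \<in> {1..d}" "c (x + unit_vec l) = c (x + unit_vec j)" for l
  proof -
    have "x + unit_vec l \<in> colour_class d c i" "x + unit_vec l \<in> closed_nbhd d x"
      using x y l y_eq
      by (auto simp: colour_class_def closed_nbhd_def open_nbhd_def adjacent_iff cube_eq)
    then have "x + unit_vec l = x + unit_vec j" using sole y_eq by blast
    then show "l = j" by simp
  qed
  then have "lone c (y + unit_vec j) j" by (simp add: lone_def y_eq)
  moreover have "y \<in> D" using j x y_eq by simp
  ultimately have "j = j0" using lone_eq_if_splits[OF sp j] by blast
  with \<open>y \<in> D\<close> y_eq show ?thesis by simp
qed

text \<open>
  Each closed neighbourhood of a vertex of \<open>I\<close> contains every colour, which handles single vertices
  and surjectivity. A pair could fail only if both vertices had the same sole defender. This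
  defender lies in \<open>I\<close> if it is one of the two vertices. It lies in \<open>D\<close> and is adjacent in direction
  \<open>j0\<close> to each of the two vertices that it differs from (\<open>sole_defender\<close>). Hence it differs from
  both, and they coincide.
\<close>
lemma splits_extremal:
  assumes d: "d + 3 = 2 * q" and j0: "j0 \<in> {1..d}"
    and sp: "\<And>b. b \<in> D \<Longrightarrow> splits_at c b j0"
    and c: "c \<in> cube {1..d} \<rightarrow>\<^sub>E {1..q}"
    and I: "\<And>x. x \<in> I \<Longrightarrow> c x \<notin> (\<lambda>j. c (x + unit_vec j)) ` {1..d}"
  shows "extremal d I q c"
proof -
  have cI: "c x \<in> {1..q}" if "x \<in> I \<or> x \<in> D" for x using c that cube_eq by blast
  have nb: "(\<lambda>j. c (x + unit_vec j)) ` {1..d} = {1..q} - {c x}" if x: "x \<in> I" for x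
  proof (rule card_subset_eq)
    show "(\<lambda>j. c (x + unit_vec j)) ` {1..d} \<subseteq> {1..q} - {c x}"
    proof (intro image_subsetI DiffI)
      fix j assume j: "j \<in> {1..d}"
      then show "c (x + unit_vec j) \<in> {1..q}" using x cI by simp
      show "c (x + unit_vec j) \<notin> {c x}"
        using I[OF x] imageI[OF j, of "\<lambda>j. c (x + unit_vec j)"] by auto
    qed
    show "card ((\<lambda>j. c (x + unit_vec j)) ` {1..d}) = card ({1..q} - {c x})"
      using card_neighbour_colours_if_splits[OF d j0 sp x] cI[of x] x by simp
  qed simp
  have ex: "\<exists>y. y \<in> colour_class d c i \<and> y \<in> closed_nbhd d x" if "x \<in> I" "i \<in> {1..q}" for x i
  proof (cases "i = c x")
    case True
    then show ?thesis using that
      by (intro exI[of _ x]) (simp add: colour_class_def closed_nbhd_def cube_eq)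
  next
    case False
    then have "i \<in> (\<lambda>j. c (x + unit_vec j)) ` {1..d}" using that nb by blast
    then obtain j where "j \<in> {1..d}" "c (x + unit_vec j) = i" by blast
    with that show ?thesis
      by (intro exI[of _ "x + unit_vec j"])
        (auto simp: colour_class_def closed_nbhd_def open_nbhd_def adjacent_iff cube_eq)
  qed
  have proper: "c x \<noteq> c y" if adj: "adjacent d x y" for x y
  proof -
    have I': "c z \<noteq> c (z + unit_vec j)" if "z \<in> I" "j \<in> {1..d}" for z j
      using I[OF that(1)] that(2) by (metis image_eqI)
    from adj obtain j where j: "x \<in> I \<union> D" "j \<in> {1..d}" and y: "y = x + unit_vec j"
      unfolding adjacent_iff cube_eq by blast
    then consider "x \<in> I" | "x + unit_vec j \<in> I" by auto
    then show ?thesis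
    proof cases
      case 1
      then show ?thesis using I'[OF 1 j(2)] y by simp
    next
      case 2
      then show ?thesis using I'[OF 2 j(2)] y by simp
    qed
  qed
  have surj: "c ` cube {1..d} = {1..q}"
  proof
    show "c ` cube {1..d} \<subseteq> {1..q}" using c by blast
    have "0 \<in> I \<union> D" unfolding cube_eq[symmetric] by (simp add: cube_def)
    then obtain x where x: "x \<in> I" using j0 flip_in_I[of j0 0] by blast
    show "{1..q} \<subseteq> c ` cube {1..d}"
    proof
      fix i assume "i \<in> {1..q}"
      with ex[OF x] obtain y where "y \<in> colour_class d c i" by blast
      then show "i \<in> c ` cube {1..d}" unfolding colour_class_def by blast
    qed
  qed
  have defend: "\<exists>f. f \<in> S \<rightarrow> colour_class d c i \<and> inj_on f S \<and> (\<forall>x\<in>S. f x \<in> closed_nbhd d x)"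
    if i: "i \<in> {1..q}" and S: "S \<subseteq> I" "card S \<le> 2" for i S
  proof -
    have finS: "finite S" using S(1) finite_I by (rule finite_subset)
    then consider "S = {}" | x where "S = {x}" | x x' where "S = {x, x'}" "x \<noteq> x'"
      using S(2) by (metis One_nat_def card_0_eq card_1_singletonE card_2_iff le_SucE le_zero_eq
        numeral_2_eq_2)
    then show ?thesis
    proof cases
      case 1 then show ?thesis by simp
    next
      case (2 x)
      with ex[of x i] i S obtain y where "y \<in> colour_class d c i" "y \<in> closed_nbhd d x" by blast
      with 2 show ?thesis by (intro exI[of _ "\<lambda>_. y"]) simp
    next
      case (3 x x')
      let ?K = "\<lambda>x y. y \<in> colour_class d c i \<and> y \<in> closed_nbhd d x"
      have xI: "x \<in> I" "x' \<in> I" using 3 S by auto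
      have "\<exists>y y'. ?K x y \<and> ?K x' y' \<and> y \<noteq> y'"
      proof (rule ccontr)
        assume no: "\<not> ?thesis"
        obtain y where y: "?K x y" "?K x' y" using ex xI i no by metis
        have K_eq: "z = y" if "?K x z \<or> ?K x' z" for z using no y that by metis
        have sole: "y \<in> D \<and> w = y + unit_vec j0"
          if "w \<in> I" "?K w y" "y \<noteq> w" "\<And>z. ?K w z \<Longrightarrow> z = y" for w
          using sole_defender[OF sp that(1)] that(2,3,4) by blast
        show False
        proof (cases "y = x \<or> y = x'")
          case True
          then have "y \<in> I" using xI by auto
          then show False using sole[of x] sole[of x'] xI y K_eq 3(2) I_D_disjoint by metis
        next
          case False
          then show False using sole[of x] sole[of x'] xI y K_eq 3(2) by metis
        qed
      qed
      then obtain y y' where "?K x y" "?K x' y'" "y \<noteq> y'" by blast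
      with 3 show ?thesis
        by (intro exI[of _ "\<lambda>z. if z = x then y else y'"]) (auto simp: inj_on_def)
    qed
  qed
  show ?thesis
    unfolding extremal_def pair_defensive_def surj_proper_colouring_def
    using c surj proper defend d by auto
qed

text \<open>
  The colour of a vertex of \<open>I\<close> is the one that its neighbours, all in \<open>D\<close>, do not use.
\<close>
lemma pair_defensive_eqI:
  assumes pd: "pair_defensive d I q c" "pair_defensive d I q c'"
    and D: "\<And>b. b \<in> D \<Longrightarrow> c b = c' b"
  shows "c = c'"
proof (rule PiE_ext)
  show "c \<in> cube {1..d} \<rightarrow>\<^sub>E {1..q}" "c' \<in> cube {1..d} \<rightarrow>\<^sub>E {1..q}"
    using pd by (simp_all add: pair_defensive_def surj_proper_colouring_def)
  fix x assume x: "x \<in> cube {1..d}"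
  show "c x = c' x"
  proof (cases "x \<in> I")
    case True
    have "(\<lambda>j. c (x + unit_vec j)) ` {1..d} = (\<lambda>j. c' (x + unit_vec j)) ` {1..d}"
      by (rule image_cong) (use True D in simp_all)
    then have "{1..q} - {c x} = {1..q} - {c' x}"
      by (simp only: neighbour_colours[OF pd(1) True] neighbour_colours[OF pd(2) True])
    then show ?thesis
      using colour_in_range[OF pd(1) x] colour_in_range[OF pd(2) x] by blast
  next
    case False
    with x D show ?thesis unfolding cube_eq by blast
  qed
qed

lemma splits_at_cong:
  assumes "b \<in> D" "\<And>b. b \<in> D \<Longrightarrow> c b = c' b" "\<delta> \<in> {1..d}"
  shows "splits_at c b \<delta> \<longleftrightarrow> splits_at c' b \<delta>"
proof -
  have "c (b + unit_vec j + unit_vec l) = c' (b + unit_vec j + unit_vec l)"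
    if "j \<in> {1..d}" "l \<in> {1..d}" for j l
    using assms that by simp
  then show ?thesis
    unfolding splits_at_def using assms by (simp cong: conj_cong)
qed

lemma extremal_extension:
  assumes d: "d + 3 = 2 * q" and j0: "j0 \<in> {1..d}"
    and sp: "\<And>b. b \<in> D \<Longrightarrow> splits_at g b j0" and g: "\<And>b. b \<in> D \<Longrightarrow> g b \<in> {1..q}"
  shows "\<exists>c. extremal d I q c \<and> (\<forall>b\<in>D. c b = g b)"
proof -
  let ?seen = "\<lambda>x. (\<lambda>j. g (x + unit_vec j)) ` {1..d}"
  have "\<exists>i. i \<in> {1..q} \<and> i \<notin> ?seen x" if x: "x \<in> I" for x
  proof (rule ccontr)
    assume "\<not> ?thesis"
    then have "{1..q} \<subseteq> ?seen x" by blast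
    then have "q \<le> card (?seen x)"
      using card_mono[of "?seen x" "{1..q}"] by simp
    then show False using card_neighbour_colours_if_splits[OF d j0 sp x] d by simp
  qed
  then obtain m where m: "\<And>x. x \<in> I \<Longrightarrow> m x \<in> {1..q} \<and> m x \<notin> ?seen x"
    by metis
  define c where "c = restrict (\<lambda>x. if x \<in> D then g x else m x) (cube {1..d})"
  have cD: "c b = g b" if "b \<in> D" for b using that by (simp add: c_def cube_eq)
  have cI: "c x = m x" if "x \<in> I" for x using that I_D_disjoint by (simp add: c_def cube_eq)
  have "extremal d I q c"
  proof (rule splits_extremal[OF d j0])
    show "splits_at c b j0" if "b \<in> D" for b
      using splits_at_cong[of b c g j0] that cD j0 sp by blast
    show "c \<in> cube {1..d} \<rightarrow>\<^sub>E {1..q}"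
      using g m cD cI unfolding cube_eq by (auto simp: c_def cube_eq)
    show "c x \<notin> (\<lambda>j. c (x + unit_vec j)) ` {1..d}" if x: "x \<in> I" for x
    proof -
      have "(\<lambda>j. c (x + unit_vec j)) ` {1..d} = ?seen x"
        by (rule image_cong) (use x cD in simp_all)
      then show ?thesis using m[OF x] by (simp only: cI[OF x] not_False_eq_True)
    qed
  qed
  then show ?thesis using cD by blast
qed

section \<open>Deleting the defect coordinate\<close>

definition reduced :: "nat \<Rightarrow> ((nat \<Rightarrow> bit) \<Rightarrow> nat) \<Rightarrow> (nat \<Rightarrow> bit) \<Rightarrow> bool" where
  "reduced j0 \<gamma> v \<longleftrightarrow>
     (\<forall>j \<in> {1..d} - {j0}. \<gamma> (v + unit_vec j) \<noteq> \<gamma> v) \<and>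
     perfect_matching
       {{j, l} | j l. j \<in> {1..d} - {j0} \<and> l \<in> {1..d} - {j0} \<and> j \<noteq> l \<and>
          \<gamma> (v + unit_vec j + unit_vec l) = \<gamma> v}
       ({1..d} - {j0})"

text \<open>
  A single flip of \<open>delete_coord j0 b\<close> leaves the parity class when lifted to \<open>b\<close>, and has to be
  corrected by a flip of \<open>j0\<close>; a double flip lifts as it is.
\<close>
lemma reduced_iff_splits:
  assumes j0: "j0 \<in> {1..d}" and b: "b \<in> D"
    and \<gamma>: "\<And>b. b \<in> D \<Longrightarrow> \<gamma> (delete_coord j0 b) = c b"
  shows "reduced j0 \<gamma> (delete_coord j0 b) \<longleftrightarrow> splits_at c b j0"
proof -
  have one: "\<gamma> (delete_coord j0 b + unit_vec j) = c (b + unit_vec j0 + unit_vec j)"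
    if "j \<in> {1..d} - {j0}" for j
    using \<gamma>[of "b + unit_vec j0 + unit_vec j"] that j0 b
    by (simp add: delete_coord_add_unit_vec delete_coord_add_same)
  have two: "\<gamma> (delete_coord j0 b + unit_vec j + unit_vec l) = c (b + unit_vec j + unit_vec l)"
    if "j \<in> {1..d} - {j0}" "l \<in> {1..d} - {j0}" for j l
    using \<gamma>[of "b + unit_vec j + unit_vec l"] that b by (simp add: delete_coord_add_unit_vec)
  show ?thesis
    unfolding reduced_def splits_at_def
    by (subst perfect_matching_pairs_iff)
      (auto simp: one two \<gamma>[OF b] add_unit_vec_commute cong: conj_cong)
qed

lemma transport_bij:
  assumes d: "d + 3 = 2 * q" and j0: "j0 \<in> {1..d}"
  shows "bij_betw (transport d D j0)
      {c. extremal d I q c \<and> (\<forall>b\<in>D. defect d c b = j0)}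
      {\<gamma> \<in> cube ({1..d} - {j0}) \<rightarrow>\<^sub>E {1..q}. \<forall>v \<in> cube ({1..d} - {j0}). reduced j0 \<gamma> v}"
    (is "bij_betw ?T ?C ?G")
proof (rule bij_betw_imageI)
  let ?V = "cube ({1..d} - {j0})"
  have V: "?V = delete_coord j0 ` D" using bij_delete_coord[OF j0] by (simp add: bij_betw_def)
  have T: "?T c (delete_coord j0 b) = c b" if "b \<in> D" for b c
    by (rule transport_delete_coord[OF j0 that])
  have pd: "pair_defensive d I q c" if "c \<in> ?C" for c
    using that unfolding extremal_def by blast
  show "inj_on ?T ?C"
  proof (rule inj_onI)
    fix c c' assume c: "c \<in> ?C" "c' \<in> ?C" and eq: "?T c = ?T c'"
    have "c b = c' b" if "b \<in> D" for b
      using T[OF that, of c] T[OF that, of c'] by (simp add: eq)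
    then show "c = c'" by (rule pair_defensive_eqI[OF pd[OF c(1)] pd[OF c(2)]])
  qed
  show "?T ` ?C = ?G"
  proof (intro subset_antisym image_subsetI)
    fix c assume c: "c \<in> ?C"
    have "?T c \<in> extensional ?V" by (simp add: transport_def)
    moreover have "?T c v \<in> {1..q} \<and> reduced j0 (?T c) v" if "v \<in> ?V" for v
    proof -
      obtain b where b: "b \<in> D" and v: "v = delete_coord j0 b" using \<open>v \<in> ?V\<close> V by blast
      obtain \<delta> where \<delta>: "\<delta> \<in> {1..d}" "splits_at c b \<delta>"
        using pair_defensive_splits[OF pd[OF c] d b] by blast
      moreover have "defect d c b = j0" using c b by blast
      ultimately have "splits_at c b j0" using defect_eq[OF \<delta>(2,1)] by simp
      then have "reduced j0 (?T c) v" using reduced_iff_splits[OF j0 b, of "?T c" c] T v by simp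
      moreover have "?T c v \<in> {1..q}"
        using colour_in_range[OF pd[OF c], of b] b unfolding v T[OF b] cube_eq by blast
      ultimately show ?thesis by blast
    qed
    ultimately show "?T c \<in> ?G" by (simp add: PiE_iff)
  next
    show "?G \<subseteq> ?T ` ?C"
    proof
      fix \<gamma> assume \<gamma>: "\<gamma> \<in> ?G"
      let ?g = "\<lambda>b. \<gamma> (delete_coord j0 b)"
      have g: "?g b \<in> {1..q}" "splits_at ?g b j0" if b: "b \<in> D" for b
      proof -
        have "delete_coord j0 b \<in> ?V" using b V by blast
        with \<gamma> show "?g b \<in> {1..q}" by blast
        have "reduced j0 \<gamma> (delete_coord j0 b)" using \<gamma> \<open>delete_coord j0 b \<in> ?V\<close> by blast
        then show "splits_at ?g b j0" using reduced_iff_splits[OF j0 b, of \<gamma> ?g] by simp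
      qed
      obtain c where ext: "extremal d I q c" and cD: "\<And>b. b \<in> D \<Longrightarrow> c b = ?g b"
        using extremal_extension[OF d j0 g(2) g(1)] by blast
      have "splits_at c b j0" if "b \<in> D" for b
        using splits_at_cong[of b c ?g j0] that cD j0 g(2) by blast
      then have "c \<in> ?C" using ext defect_eq[OF _ j0] by blast
      moreover have "\<gamma> = ?T c"
      proof (rule extensionalityI)
        show "\<gamma> \<in> extensional ?V" using \<gamma> by (simp add: PiE_iff)
        show "?T c \<in> extensional ?V" by (simp add: transport_def)
        fix v assume "v \<in> ?V"
        then obtain b where "b \<in> D" "v = delete_coord j0 b" using V by blast
        then show "\<gamma> v = ?T c v" by (simp add: T cD)
      qed
      ultimately show "\<gamma> \<in> ?T ` ?C" by blast
    qed
  qed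
qed

end

theorem proposition5p5:
  fixes q d j0 :: nat and I D :: "(nat \<Rightarrow> bit) set"
  assumes "q \<ge> 2"
    and "d = 2 * q - 3"
    and "I = even_class d \<and> D = odd_class d \<or> I = odd_class d \<and> D = even_class d"
    and "j0 \<in> {1..d}"
  shows "bij_betw (delete_coord j0) D (cube ({1..d} - {j0})) \<and>
    bij_betw (transport d D j0)
      {c. extremal d I q c \<and> (\<forall>b\<in>D. defect d c b = j0)}
      {\<gamma> \<in> cube ({1..d} - {j0}) \<rightarrow>\<^sub>E {1..q}.
         \<forall>v \<in> cube ({1..d} - {j0}).
           (\<forall>j \<in> {1..d} - {j0}. \<gamma> (v + unit_vec j) \<noteq> \<gamma> v) \<and>
           perfect_matching
             {{j, l} | j l. j \<in> {1..d} - {j0} \<and> l \<in> {1..d} - {j0} \<and> j \<noteq> l \<and>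
                \<gamma> (v + unit_vec j + unit_vec l) = \<gamma> v}
             ({1..d} - {j0})}"
proof -
  interpret parity_classes d I D by standard (fact assms(3))
  have d: "d + 3 = 2 * q" using assms(1,2) by simp
  show ?thesis
    using bij_delete_coord[OF assms(4)] transport_bij[OF d assms(4)] unfolding reduced_def by blast
qed

end
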